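(* Let $n\ge1$, $0<s<1$, $a\in\mathbb{R}$ and $\omega\in\mathbb{S}^{n-1}$. If the halfspace $H_{\omega,a}:=\{x\in\mathbb{R}^n:\langle x,\omega\rangle<a\}$ is stationary with respect to the non local Gaussian isoperimetric problem, then $a=0$, or equivalently $$\frac{1}{(2\pi)^{\frac n2}}\int_{H_{\omega,a}}e^{-\frac{|x|^2}{2}}\,dx=\frac12.$$
   Context: Here $\mathbb{S}^{n-1}$ is the unit sphere of $\mathbb{R}^n$. The non local Gaussian perimeter of a measurable set $E\subset\mathbb{R}^n$ is $\mathcal{J}^{\gamma}_s(E)=\int_E\int_{E^c}\frac{e^{-\frac14(|x|^2+|y|^2)}}{|x-y|^{n+s}}\,dx\,dy$. A set $E\subset\mathbb{R}^n$ of class $C^2$ is said to be stationary with respect to the non local Gaussian isoperimetric problem (equivalently, a volume constrained critical point of $\mathcal{J}^{\gamma}_s$, the constraint being on the Gaussian volume) if there exists $\lambda\in\mathbb{R}$ such that $$\int_{\mathbb{R}^n}\big(\chi_{E^c}(y)-\chi_E(y)\big)\frac{e^{-\frac14|y|^2}}{|x-y|^{n+s}}\,dy=\lambda\,e^{-\frac{|x|^2}{4}}\qquad\text{for all }x\in\partial E,$$ where $\chi_A$ denotes the characteristic function of a set $A$ and the integral is understood in the principal value sense, i.e. as the limit as $\varepsilon\to0^+$ of the integral over $\{y:|x-y|>\varepsilon\}$.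
   Formalization: The implication "stationary implies a = 0" is stated for n ≥ 2 only: for n = 1 the boundary is a single point, so every half-line is stationary and the claim fails for a ≠ 0. The equivalence of a = 0 with Gaussian volume 1/2 is kept for all n ≥ 1. *)

theory Defs
  imports "HOL-Analysis.Analysis"
begin

(* The truncated integrals are required to exist, so that the value 0 which the library assigns to
   a non-integrable function plays no role. *)
definition has_pv_integral :: "('a::euclidean_space \<Rightarrow> real) \<Rightarrow> real \<Rightarrow> 'a \<Rightarrow> bool" where
  "has_pv_integral f I x \<longleftrightarrow>
     (\<forall>\<epsilon>>0. set_integrable lborel {y. dist x y > \<epsilon>} f) \<and>
     ((\<lambda>\<epsilon>. LINT y:{y. dist x y > \<epsilon>}|lborel. f y) \<longlongrightarrow> I) (at_right 0)"

(* Meant for sets E of class C^2; half-spaces are of this class, so the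
   regularity of E is not part of the predicate. *)
definition nonlocal_gauss_stationary :: "real \<Rightarrow> (real ^ 'n) set \<Rightarrow> bool" where
  "nonlocal_gauss_stationary s E \<longleftrightarrow>
     (\<exists>l::real. \<forall>x \<in> frontier E.
        has_pv_integral
          (\<lambda>y. (indicat_real (- E) y - indicat_real E y) *
               (exp (- (norm y)\<^sup>2 / 4) / norm (x - y) powr (real CARD('n) + s)))
          (l * exp (- (norm x)\<^sup>2 / 4)) x)"

definition open_halfspace :: "real ^ 'n \<Rightarrow> real \<Rightarrow> (real ^ 'n) set" where
  "open_halfspace \<omega> a = {x. x \<bullet> \<omega> < a}"

definition gauss_volume :: "(real ^ 'n) set \<Rightarrow> real" where
  "gauss_volume E =
     1 / (2 * pi) powr (real CARD('n) / 2) * (LINT x:E|lborel. exp (- (norm x)\<^sup>2 / 2))"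

end

(* Pair each y with its mirror image in the boundary hyperplane, which has the same distance to the
   boundary point x. With t = <y, \<omega>> - a, the two contributions to the principal value add up to
   exp (-|y|^2/4) / |x - y|^(n+s) times \<plusminus>|1 - exp (a t)|, whose sign is that of -a throughout. There is
   thus no cancellation, and already the unit ball around (a+2)\<omega> makes the integral at least of order
   |x|^-(n+s) when a is nonzero. Stationarity makes it decay like a Gaussian along the boundary, which
   is unbounded as soon as n is at least 2. *)
theory Submission
  imports Defs "HOL-Probability.Distributions" "HOL-Real_Asymp.Real_Asymp"
begin

section \<open>Invariance of Lebesgue measure under isometries\<close>

lemma lborel_distr_translate: "distr lborel borel (\<lambda>x. t + x) = (lborel :: 'a::euclidean_space measure)"
  using lborel_affine[of 1 t] by (simp add: density_1)
lemma lborel_distr_point_reflect: "distr lborel borel (\<lambda>x. t - x) = (lborel :: 'a::euclidean_space measure)"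
  using lborel_affine[of "-1" t] by (simp add: density_1)
text \<open>With \<open>B\<close> the unit ball and \<open>\<lambda>\<close> Lebesgue measure, Fubini and translation invariance applied to
  \<open>\<integral>\<integral> 1\<^sub>B(y) 1\<^sub>A(f x + y)\<close> give \<open>\<lambda>(B) \<lambda>(f\<^sup>-\<^sup>1 A) = \<lambda>(A) \<lambda>(B)\<close>. The library's change of
  variables is not applicable to an arbitrary Euclidean space: it needs a well-ordered index type.\<close>
lemma lborel_distr_orthogonal:
  fixes f :: "'a::euclidean_space \<Rightarrow> 'a"
  assumes f: "orthogonal_transformation f"
  shows "distr lborel borel f = lborel"
proof (rule measure_eqI)
  fix A assume "A \<in> sets (distr lborel borel f)"
  then have A [measurable]: "A \<in> sets borel" by simp
  have [measurable]: "f \<in> borel_measurable borel"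
    by (intro borel_measurable_continuous_onI linear_continuous_on)
      (use f orthogonal_transformation_linear linear_conv_bounded_linear in blast)
  have lin: "f (x + y) = f x + f y" "f (x - y) = f x - f y" and norm: "norm (f x) = norm x" for x y
    using f by (auto simp: orthogonal_transformation_linear linear_add linear_diff orthogonal_transformation_norm)
  obtain g where g: "f (g y) = y" for y
    using orthogonal_transformation_surj[OF f] by (metis surj_def)
  let ?B = "ball 0 1 :: 'a set"
  have [measurable]: "?B \<in> sets borel"
    by simp
  let ?\<mu> = "emeasure lborel :: 'a set \<Rightarrow> ennreal"
  \<comment> \<open>Translating \<open>x\<close> by \<open>g y\<close> turns \<open>f x\<close> into
    \<open>f x + y\<close>, so the inner integral is the same for every \<open>y\<close>.\<close>
  have shift: "(\<integral>\<^sup>+x. indicator A (f x) \<partial>lborel) = (\<integral>\<^sup>+x. indicator A (f x + y) \<partial>lborel)" for y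
    by (subst lborel_distr_translate[of "g y", symmetric])
      (simp add: nn_integral_distr lin g add.commute)
  \<comment> \<open>Since \<open>y - f x = f (g y - x)\<close> and \<open>f\<close> preserves norms,
    membership in the unit ball can be tested without \<open>f\<close>.\<close>
  have refl: "(\<integral>\<^sup>+x. indicator ?B (y - f x) \<partial>lborel) = ?\<mu> ?B" for y
  proof -
    have "(indicator ?B (y - f x) :: ennreal) = indicator ?B (g y - x)" for x
      using norm[of "g y - x"] by (simp add: indicator_def lin g)
    then have "(\<integral>\<^sup>+x. indicator ?B (y - f x) \<partial>lborel) = (\<integral>\<^sup>+x. indicator ?B (g y - x) \<partial>lborel)"
      by simp
    also have "\<dots> = (\<integral>\<^sup>+x. indicator ?B x \<partial>distr lborel borel (\<lambda>x. g y - x))"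
      by (subst nn_integral_distr) simp_all
    also have "\<dots> = ?\<mu> ?B"
      by (simp add: lborel_distr_point_reflect)
    finally show ?thesis .
  qed
  have "?\<mu> ?B * emeasure (distr lborel borel f) A = ?\<mu> ?B * (\<integral>\<^sup>+x. indicator A (f x) \<partial>lborel)"
    by (simp add: nn_integral_distr flip: nn_integral_indicator)
  also have "\<dots> = (\<integral>\<^sup>+y. indicator ?B y * (\<integral>\<^sup>+x. indicator A (f x) \<partial>lborel) \<partial>lborel)"
    by (simp add: nn_integral_multc)
  also have "\<dots> = (\<integral>\<^sup>+y. (\<integral>\<^sup>+x. indicator ?B y * indicator A (f x + y) \<partial>lborel) \<partial>lborel)"
    by (simp add: nn_integral_cmult flip: shift)
  also have "\<dots> = (\<integral>\<^sup>+x. (\<integral>\<^sup>+y. indicator ?B y * indicator A (f x + y) \<partial>lborel) \<partial>lborel)"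
    by (rule lborel_pair.Fubini') measurable
  also have "\<dots> = (\<integral>\<^sup>+x. (\<integral>\<^sup>+y. indicator A y * indicator ?B (y - f x) \<partial>lborel) \<partial>lborel)"
  proof (rule nn_integral_cong)
    fix x
    show "(\<integral>\<^sup>+y. indicator ?B y * indicator A (f x + y) \<partial>lborel) =
          (\<integral>\<^sup>+y. indicator A y * indicator ?B (y - f x) \<partial>lborel)"
      by (subst lborel_distr_translate[of "- f x", symmetric])
        (simp add: nn_integral_distr mult.commute)
  qed
  also have "\<dots> = (\<integral>\<^sup>+y. (\<integral>\<^sup>+x. indicator A y * indicator ?B (y - f x) \<partial>lborel) \<partial>lborel)"
    by (rule lborel_pair.Fubini'[symmetric]) measurable
  also have "\<dots> = ?\<mu> ?B * emeasure lborel A"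
    by (simp add: nn_integral_cmult refl nn_integral_multc mult.commute)
  finally have "?\<mu> ?B * emeasure (distr lborel borel f) A = ?\<mu> ?B * emeasure lborel A" .
  moreover have "?\<mu> ?B < \<infinity>"
    by (rule emeasure_lborel_ball_finite)
  moreover have "?\<mu> ?B \<noteq> 0"
    using content_ball_pos[of 1 "0::'a"] by (auto simp: measure_def)
  ultimately show "emeasure (distr lborel borel f) A = emeasure lborel A"
    by (auto simp: ennreal_mult_cancel_left)
qed simp

section \<open>Lower bounds for integrals, null hyperplanes and the Gaussian integral\<close>

text \<open>The minorant is \<open>c\<close> times the indicator of the ball. This serves twice: for
  the paired kernel and for the Gaussian mass of a strip between two hyperplanes.\<close>

lemma integral_ge_cball:
  fixes f :: "'a::euclidean_space \<Rightarrow> real"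
  assumes "integrable lborel f" and "AE x in lborel. 0 \<le> f x"
    and ge: "\<And>x. x \<in> cball z r \<Longrightarrow> c \<le> f x"
  shows "c * measure lborel (cball z r) \<le> integral\<^sup>L lborel f"
proof -
  have "c * measure lborel (cball z r) = (\<integral>x. c * indicator (cball z r) x \<partial>lborel)"
    by simp
  also have "\<dots> \<le> integral\<^sup>L lborel f"
  proof (rule integral_mono_AE)
    show "AE x in lborel. c * indicator (cball z r) x \<le> f x"
      using assms(2) by eventually_elim (simp add: indicator_def ge flip: mem_cball)
    show "integrable lborel (\<lambda>x. c * indicator (cball z r) x)"
      using emeasure_lborel_cball_finite[of z r] by (intro integrable_mult_right integrable_real_indicator) auto
  qed (fact assms(1))
  finally show ?thesis .
qed

lemma AE_lborel_not_hyperplane: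
  fixes \<omega> :: "'a::euclidean_space"
  assumes "\<omega> \<noteq> 0"
  shows "AE x in lborel. x \<bullet> \<omega> \<noteq> a"
proof -
  have "negligible {x. \<omega> \<bullet> x = a}"
    using assms by (intro negligible_hyperplane) simp
  then have "{x. \<omega> \<bullet> x = a} \<in> null_sets lebesgue"
    by (simp add: negligible_iff_null_sets)
  then have "AE x in lebesgue. x \<bullet> \<omega> \<noteq> a"
    by (rule AE_I') (auto simp: inner_commute)
  then show ?thesis
    by (simp add: AE_completion_iff)
qed

text \<open>The Gaussian factorises over the coordinates, and the one-dimensional integral is read
  off from the normalisation of the standard normal density.\<close>

lemma has_bochner_integral_gauss:
  "has_bochner_integral lborel (\<lambda>x::'a::euclidean_space. exp (- (norm x)\<^sup>2 / 2))
     ((2 * pi) powr (DIM('a) / 2))"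
proof (rule has_bochner_integral_nn_integral)
  have 1: "(\<integral>\<^sup>+t. ennreal (exp (- t\<^sup>2 / 2)) \<partial>lborel) = ennreal (sqrt (2 * pi))"
  proof -
    have "(\<integral>\<^sup>+t. ennreal (exp (- t\<^sup>2 / 2)) \<partial>lborel)
        = (\<integral>\<^sup>+t. ennreal (sqrt (2 * pi) * std_normal_density t) \<partial>lborel)"
      by (simp add: std_normal_density_def)
    also have "\<dots> = ennreal (\<integral>t. sqrt (2 * pi) * std_normal_density t \<partial>lborel)"
      by (rule nn_integral_eq_integral) auto
    finally show ?thesis by simp
  qed
  have "(\<integral>\<^sup>+(x::'a). ennreal (exp (- (norm x)\<^sup>2 / 2)) \<partial>lborel)
      = (\<integral>\<^sup>+(x::'a). (\<Prod>b\<in>Basis. ennreal (exp (- (x \<bullet> b)\<^sup>2 / 2))) \<partial>lborel)"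
  proof (rule nn_integral_cong)
    fix x :: 'a
    have "(norm x)\<^sup>2 = (\<Sum>b\<in>Basis. (x \<bullet> b)\<^sup>2)"
      unfolding power2_norm_eq_inner by (subst euclidean_inner) (simp add: power2_eq_square)
    then have "- (norm x)\<^sup>2 / 2 = (\<Sum>b\<in>Basis. - (x \<bullet> b)\<^sup>2 / 2)"
      by (simp add: sum_divide_distrib sum_negf)
    then show "ennreal (exp (- (norm x)\<^sup>2 / 2)) = (\<Prod>b\<in>Basis. ennreal (exp (- (x \<bullet> b)\<^sup>2 / 2)))"
      by (simp only: exp_sum finite_Basis) (simp add: prod_ennreal)
  qed
  also have "\<dots> = (\<Prod>b\<in>(Basis::'a set). ennreal (sqrt (2 * pi)))"
    by (subst nn_integral_lborel_prod) (simp_all add: 1[simplified])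
  also have "\<dots> = ennreal (sqrt (2 * pi) ^ DIM('a))"
    by (simp add: ennreal_power)
  also have "sqrt (2 * pi) ^ DIM('a) = (2 * pi) powr (DIM('a) / 2)"
    by (simp add: powr_half_sqrt[symmetric] powr_realpow[symmetric] powr_powr)
  finally show "(\<integral>\<^sup>+(x::'a). ennreal (exp (- (norm x)\<^sup>2 / 2)) \<partial>lborel) = ennreal ((2 * pi) powr (DIM('a) / 2))" .
qed auto

lemma gauss_beats_powr:
  fixes p M :: real
  assumes "0 < p"
  shows "((\<lambda>r. (r + M) powr p * exp (- r\<^sup>2 / 4)) \<longlongrightarrow> 0) at_top"
  using assms by real_asymp

section \<open>Reflection in an affine hyperplane\<close>

lemma orthogonal_transformation_reflection:
  fixes \<omega> :: "'a::euclidean_space"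
  assumes "norm \<omega> = 1"
  shows "orthogonal_transformation (\<lambda>y. y - (2 * (y \<bullet> \<omega>)) *\<^sub>R \<omega>)"
proof -
  have "\<omega> \<bullet> \<omega> = 1"
    using assms by (simp add: norm_eq_1)
  then show ?thesis
    by (auto simp: orthogonal_transformation_def inner_simps linear_iff algebra_simps inner_commute)
qed

text \<open>The affine reflection is the linear one followed by a translation by
  \<open>2 * a\<close> in direction \<open>\<omega>\<close>, and both preserve Lebesgue
  measure.\<close>

lemma lborel_distr_reflection:
  fixes \<omega> :: "'a::euclidean_space"
  assumes "norm \<omega> = 1"
  shows "distr lborel borel (\<lambda>y. y - (2 * (y \<bullet> \<omega> - a)) *\<^sub>R \<omega>) = lborel"
proof -
  let ?L = "\<lambda>y. y - (2 * (y \<bullet> \<omega>)) *\<^sub>R \<omega>"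
  have "distr lborel borel (\<lambda>y. y - (2 * (y \<bullet> \<omega> - a)) *\<^sub>R \<omega>)
      = distr (distr lborel borel ?L) borel (\<lambda>x. (2 * a) *\<^sub>R \<omega> + x)"
    by (subst distr_distr) (simp_all add: o_def algebra_simps)
  then show ?thesis
    by (simp add: lborel_distr_orthogonal[OF orthogonal_transformation_reflection[OF assms]]
        lborel_distr_translate)
qed

section \<open>Lower bound for the truncated kernel integral\<close>

text \<open>Keeps the factor produced by the mirror pairing away from 0, uniformly in
  \<open>t \<ge> 1\<close>, for either sign of \<open>a\<close>.\<close>

lemma one_minus_exp_ge:
  fixes a t :: real
  assumes "1 \<le> t"
  shows "1 - exp (- \<bar>a\<bar>) \<le> \<bar>1 - exp (a * t)\<bar>"
proof (cases "0 \<le> a")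
  case True
  then have "a \<le> a * t" using assms by (simp add: mult_le_cancel_left1)
  \<comment> \<open>The chain is
    \<open>1 - exp (- a) \<le> a \<le> a * t \<le> exp (a * t) - 1\<close>.\<close>
  then show ?thesis
    using True exp_ge_add_one_self[of "a * t"] exp_ge_add_one_self[of "- a"] by linarith
next
  case False
  then have "a * t \<le> a" using assms by (simp add: mult_le_cancel_left2)
  then have "exp (a * t) \<le> exp a" by simp
  then have "1 - exp a \<le> \<bar>1 - exp (a * t)\<bar>" by linarith
  then show ?thesis
    using False by simp
qed

text \<open>On the unit ball around \<open>(a + 2) *\<^sub>R \<omega>\<close> the offset
  \<open>y \<bullet> \<omega> - a\<close> is at least 1, \<open>norm y\<close> is at most
  \<open>\<bar>a\<bar> + 3\<close>, and so \<open>norm (x - y)\<close> is at most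
  \<open>norm x + \<bar>a\<bar> + 3\<close>; these give the three factors in front of the volume.
  The bound is independent of \<open>\<epsilon>\<close>, so it survives the limit in the principal
  value.\<close>

lemma halfspace_kernel_integral_lower_bound:
  fixes \<omega> x :: "'a::euclidean_space" and p a \<epsilon> :: real
  defines "E \<equiv> {y. y \<bullet> \<omega> < a}"
  defines "f \<equiv> \<lambda>y. (indicat_real (- E) y - indicat_real E y) *
               (exp (- (norm y)\<^sup>2 / 4) / norm (x - y) powr p)"
  assumes \<omega>: "norm \<omega> = 1" and a: "a \<noteq> 0" and x: "x \<bullet> \<omega> = a" and p: "0 \<le> p"
    and \<epsilon>: "\<epsilon> < 1" and int: "set_integrable lborel {y. dist x y > \<epsilon>} f"
  shows "(1 - exp (- \<bar>a\<bar>)) * exp (- (\<bar>a\<bar> + 3)\<^sup>2 / 4) / (norm x + \<bar>a\<bar> + 3) powr p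
           * measure lborel (cball ((a + 2) *\<^sub>R \<omega>) 1)
         \<le> 2 * \<bar>LINT y:{y. dist x y > \<epsilon>}|lborel. f y\<bar>"
proof -
  define R where "R y = y - (2 * (y \<bullet> \<omega> - a)) *\<^sub>R \<omega>" for y
  define F where "F y = indicat_real {y. dist x y > \<epsilon>} y * f y" for y
  define w where "w y = indicat_real {y. dist x y > \<epsilon>} y * (exp (- (norm y)\<^sup>2 / 4) / norm (x - y) powr p)" for y
  \<comment> \<open>The factor \<open>- sgn a\<close> makes the sum over a mirror pair nonnegative,
    so that bounding its integral from below also bounds the absolute value of the original
    one.\<close>
  define g where "g y = - sgn a * (F y + F (R y))" for y
  have \<omega>\<omega>: "\<omega> \<bullet> \<omega> = 1"
    using \<omega> by (simp add: norm_eq_1)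
  have R_inner: "R y \<bullet> \<omega> = 2 * a - y \<bullet> \<omega>" for y
    by (simp add: R_def inner_simps \<omega>\<omega> algebra_simps)
  \<comment> \<open>As \<open>x\<close> lies on the mirror, \<open>R\<close> preserves the distance
    to \<open>x\<close>: the truncation and the denominator of the kernel are unchanged, and only
    the Gaussian weight changes.\<close>
  have "(norm (x - R y))\<^sup>2 = (norm (x - y))\<^sup>2" for y
    using x by (simp add: R_def power2_norm_eq_inner inner_simps \<omega>\<omega> algebra_simps inner_commute)
  then have R_dist: "norm (x - R y) = norm (x - y)" for y
    by simp
  have R_norm: "(norm (R y))\<^sup>2 = (norm y)\<^sup>2 - 4 * a * (y \<bullet> \<omega> - a)" for y
    by (simp add: R_def power2_norm_eq_inner inner_simps \<omega>\<omega> algebra_simps inner_commute)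
  have R_exp: "exp (- (norm (R y))\<^sup>2 / 4) = exp (- (norm y)\<^sup>2 / 4) * exp (a * (y \<bullet> \<omega> - a))" for y
    by (simp add: R_norm exp_add[symmetric] field_simps)
  \<comment> \<open>On the hyperplane itself \<open>R y = y\<close> and both terms carry the sign of
    the complement, so the identity can fail there.\<close>
  have g_eq: "g y = w y * \<bar>1 - exp (a * (y \<bullet> \<omega> - a))\<bar>" if "y \<bullet> \<omega> \<noteq> a" for y
  proof -
    have "F (R y) = (if y \<bullet> \<omega> < a then 1 else - 1) * w y * exp (a * (y \<bullet> \<omega> - a))"
      using that by (simp add: F_def w_def f_def E_def R_inner R_dist R_exp[simplified] dist_norm indicator_def)
    moreover have "F y = (if y \<bullet> \<omega> < a then - 1 else 1) * w y"
      by (simp add: F_def w_def f_def E_def indicator_def)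
    ultimately have g: "g y = - sgn a * (if y \<bullet> \<omega> < a then - 1 else 1) * w y * (1 - exp (a * (y \<bullet> \<omega> - a)))"
      by (simp add: g_def algebra_simps)
    have "- sgn a * (if y \<bullet> \<omega> < a then - 1 else 1) * (1 - exp (a * (y \<bullet> \<omega> - a)))
        = \<bar>1 - exp (a * (y \<bullet> \<omega> - a))\<bar>"
      using that a by (auto simp: sgn_if abs_if mult_less_0_iff zero_less_mult_iff not_less)
    then show ?thesis
      unfolding g by (metis mult.assoc mult.commute)
  qed
  have intF: "integrable lborel F"
    using int by (simp add: set_integrable_def F_def[abs_def])
  have [measurable]: "F \<in> borel_measurable borel"
    using borel_measurable_integrable[OF intF] by simp
  have [measurable]: "R \<in> borel_measurable borel"
    unfolding R_def[abs_def] by measurable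
  have distr: "distr lborel borel R = lborel"
    unfolding R_def[abs_def] by (rule lborel_distr_reflection[OF \<omega>])
  have intFR: "integrable lborel (\<lambda>y. F (R y))"
    using intF by (subst (asm) distr[symmetric]) (simp add: integrable_distr_eq)
  have FR: "(\<integral>y. F (R y) \<partial>lborel) = integral\<^sup>L lborel F"
    by (subst (2) distr[symmetric]) (simp add: integral_distr)
  have "(1 - exp (- \<bar>a\<bar>)) * exp (- (\<bar>a\<bar> + 3)\<^sup>2 / 4) / (norm x + \<bar>a\<bar> + 3) powr p
           * measure lborel (cball ((a + 2) *\<^sub>R \<omega>) 1) \<le> integral\<^sup>L lborel g"
  proof (rule integral_ge_cball)
    show "integrable lborel g"
      unfolding g_def[abs_def] using intF intFR by auto
    show "AE y in lborel. 0 \<le> g y"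
    proof (rule AE_mp[OF AE_lborel_not_hyperplane[of \<omega> a]])
      show "\<omega> \<noteq> 0"
        using \<omega> by auto
    qed (simp add: g_eq w_def)
    fix y assume "y \<in> cball ((a + 2) *\<^sub>R \<omega>) 1"
    then have y: "norm (y - (a + 2) *\<^sub>R \<omega>) \<le> 1"
      by (simp add: dist_norm norm_minus_commute)
    have "\<bar>y \<bullet> \<omega> - (a + 2)\<bar> \<le> 1"
      using Cauchy_Schwarz_ineq2[of "y - (a + 2) *\<^sub>R \<omega>" \<omega>] y by (simp add: inner_simps \<omega> \<omega>\<omega>)
    then have t: "1 \<le> y \<bullet> \<omega> - a"
      by simp
    have "norm y \<le> norm (y - (a + 2) *\<^sub>R \<omega>) + norm ((a + 2) *\<^sub>R \<omega>)"
      using norm_triangle_ineq[of "y - (a + 2) *\<^sub>R \<omega>" "(a + 2) *\<^sub>R \<omega>"] by simp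
    then have ny: "norm y \<le> \<bar>a\<bar> + 3"
      using y \<omega> by simp
    have "\<bar>(x - y) \<bullet> \<omega>\<bar> \<le> norm (x - y)"
      using Cauchy_Schwarz_ineq2[of "x - y" \<omega>] \<omega> by simp
    \<comment> \<open>Puts the ball outside the truncated region, because
      \<open>\<epsilon> < 1\<close>, and keeps the denominator positive.\<close>
    then have d: "1 \<le> norm (x - y)"
      using t x by (simp add: inner_simps)
    have "norm (x - y) \<le> norm x + \<bar>a\<bar> + 3"
      using ny norm_triangle_ineq4[of x y] by simp
    then have "norm (x - y) powr p \<le> (norm x + \<bar>a\<bar> + 3) powr p"
      using p by (intro powr_mono2) auto
    moreover have "exp (- (\<bar>a\<bar> + 3)\<^sup>2 / 4) \<le> exp (- (norm y)\<^sup>2 / 4)"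
      using ny by (simp add: power_mono)
    ultimately have "exp (- (\<bar>a\<bar> + 3)\<^sup>2 / 4) / (norm x + \<bar>a\<bar> + 3) powr p \<le> w y"
      using d \<epsilon> by (simp add: w_def dist_norm) (intro frac_le, auto)
    then have "(1 - exp (- \<bar>a\<bar>)) * (exp (- (\<bar>a\<bar> + 3)\<^sup>2 / 4) / (norm x + \<bar>a\<bar> + 3) powr p)
        \<le> \<bar>1 - exp (a * (y \<bullet> \<omega> - a))\<bar> * w y"
      using one_minus_exp_ge[OF t, of a] by (intro mult_mono) (auto simp: w_def)
    then show "(1 - exp (- \<bar>a\<bar>)) * exp (- (\<bar>a\<bar> + 3)\<^sup>2 / 4) / (norm x + \<bar>a\<bar> + 3) powr p \<le> g y"
      using t by (simp add: g_eq mult.commute)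
  qed
  also have "integral\<^sup>L lborel g \<le> 2 * \<bar>LINT y:{y. dist x y > \<epsilon>}|lborel. f y\<bar>"
  proof -
    \<comment> \<open>\<open>R\<close> preserves the measure, so both members of the pair have the
      same integral; hence the factor 2.\<close>
    have "integral\<^sup>L lborel g = - sgn a * (2 * (LINT y:{y. dist x y > \<epsilon>}|lborel. f y))"
      using intF intFR by (simp add: g_def[abs_def] FR) (simp add: set_lebesgue_integral_def F_def[abs_def])
    then show ?thesis
      using a by (cases "0 < a") simp_all
  qed
  finally show ?thesis .
qed

section \<open>Gaussian volume of half-spaces\<close>

text \<open>The map \<open>x \<mapsto> - x\<close> exchanges the two sides of a hyperplane through
  the origin, so each carries half of the total mass. Monotonicity is strict because the strip
  between two parallel hyperplanes contains a ball.\<close>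

lemma gauss_halfspace_integral:
  fixes \<omega> :: "'a::euclidean_space"
  defines "V \<equiv> \<lambda>a. LINT x:{x. x \<bullet> \<omega> < a}|lborel. exp (- (norm x)\<^sup>2 / 2)"
  assumes \<omega>: "norm \<omega> = 1"
  shows gauss_halfspace_integral_0: "2 * V 0 = (2 * pi) powr (DIM('a) / 2)"
    and gauss_halfspace_integral_strict_mono: "strict_mono V"
proof -
  let ?\<phi> = "\<lambda>x::'a. exp (- (norm x)\<^sup>2 / 2)"
  let ?F = "\<lambda>a x. indicat_real {x. x \<bullet> \<omega> < a} x * ?\<phi> x"
  have V: "V a = integral\<^sup>L lborel (?F a)" for a
    by (simp add: V_def set_lebesgue_integral_def)
  have int: "integrable lborel ?\<phi>"
    using has_bochner_integral_gauss by (rule integrable.intros)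
  have intF: "integrable lborel (?F a)" for a
    by (rule Bochner_Integration.integrable_bound[OF int]) (auto simp: indicator_def)
  have distr: "distr lborel borel (\<lambda>x::'a. 0 - x) = lborel"
    by (rule lborel_distr_point_reflect)
  have V': "V 0 = (\<integral>x. ?F 0 (0 - x) \<partial>lborel)"
    unfolding V by (subst distr[symmetric], subst integral_distr) simp_all
  have intF': "integrable lborel (\<lambda>x. ?F 0 (0 - x))"
    using intF[of 0] by (subst (asm) distr[symmetric], subst (asm) integrable_distr_eq) simp_all
  have "2 * V 0 = (\<integral>x. ?F 0 x + ?F 0 (0 - x) \<partial>lborel)"
    using intF[of 0] intF' V[of 0] V' by (subst Bochner_Integration.integral_add) simp_all
  also have "\<dots> = integral\<^sup>L lborel ?\<phi>"
  proof (rule integral_cong_AE)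
    show "AE x in lborel. ?F 0 x + ?F 0 (0 - x) = ?\<phi> x"
    proof (rule AE_mp[OF AE_lborel_not_hyperplane[of \<omega> 0]])
      show "\<omega> \<noteq> 0"
        using \<omega> by auto
    qed (auto simp: indicator_def)
  qed simp_all
  also have "\<dots> = (2 * pi) powr (DIM('a) / 2)"
    using has_bochner_integral_gauss by (rule has_bochner_integral_integral_eq)
  finally show "2 * V 0 = (2 * pi) powr (DIM('a) / 2)" .
  show "strict_mono V"
  proof (rule strict_monoI)
    fix a b :: real assume ab: "a < b"
    \<comment> \<open>The centre lies midway across the strip, and a radius of a quarter of its
      width keeps the closed ball inside.\<close>
    define z where "z = ((a + b) / 2) *\<^sub>R \<omega>"
    define r where "r = (b - a) / 4"
    have r: "0 < r"
      using ab by (simp add: r_def)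
    have "exp (- (norm z + r)\<^sup>2 / 2) * measure lborel (cball z r) \<le> (\<integral>x. ?F b x - ?F a x \<partial>lborel)"
    proof (rule integral_ge_cball)
      show "integrable lborel (\<lambda>x. ?F b x - ?F a x)"
        using intF by auto
      show "AE x in lborel. 0 \<le> ?F b x - ?F a x"
        using ab by (auto simp: indicator_def)
      fix x assume "x \<in> cball z r"
      then have x: "norm (x - z) \<le> r"
        by (simp add: dist_norm norm_minus_commute)
      have "\<omega> \<bullet> \<omega> = 1"
        using \<omega> by (simp add: norm_eq_1)
      then have "\<bar>x \<bullet> \<omega> - (a + b) / 2\<bar> \<le> r"
        using Cauchy_Schwarz_ineq2[of "x - z" \<omega>] x \<omega> by (simp add: inner_simps z_def)
      then have "a \<le> x \<bullet> \<omega>" "x \<bullet> \<omega> < b"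
        using ab unfolding r_def abs_le_iff by (simp_all add: field_simps)
      moreover have "norm x \<le> norm z + r"
        using norm_triangle_ineq[of "x - z" z] x by simp
      ultimately show "exp (- (norm z + r)\<^sup>2 / 2) \<le> ?F b x - ?F a x"
        by (simp add: indicator_def power_mono)
    qed
    also have "\<dots> = V b - V a"
      using intF by (simp add: V)
    finally show "V a < V b"
      using content_cball_pos[OF r, of z] by (smt (verit) exp_gt_zero mult_pos_pos)
  qed
qed

section \<open>Decay along the boundary and the conclusion\<close>

text \<open>Lets \<open>\<epsilon>\<close> tend to 0 in the truncated bound and inserts the
  stationarity equation. The constant \<open>C\<close> is \<open>2 * \<bar>l\<bar>\<close>; both
  constants are the same for all boundary points, and \<open>K\<close> is positive because
  \<open>a \<noteq> 0\<close>.\<close>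

lemma stationary_halfspace_decay:
  fixes \<omega> :: "real ^ 'n" and a s :: real
  assumes \<omega>: "norm \<omega> = 1" and s: "0 < s" and a: "a \<noteq> 0"
    and stat: "nonlocal_gauss_stationary s (open_halfspace \<omega> a)"
  obtains K C :: real where "0 < K" and
    "\<And>x. x \<bullet> \<omega> = a \<Longrightarrow> K / (norm x + \<bar>a\<bar> + 3) powr (CARD('n) + s) \<le> C * exp (- (norm x)\<^sup>2 / 4)"
proof -
  define p where "p = real CARD('n) + s"
  define f where "f x y = (indicat_real (- {y. y \<bullet> \<omega> < a}) y - indicat_real {y. y \<bullet> \<omega> < a} y) *
               (exp (- (norm y)\<^sup>2 / 4) / norm (x - y) powr p)" for x y
  define K where "K = (1 - exp (- \<bar>a\<bar>)) * exp (- (\<bar>a\<bar> + 3)\<^sup>2 / 4)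
      * measure lborel (cball ((a + 2) *\<^sub>R \<omega>) 1)"
  have "frontier {y. y \<bullet> \<omega> < a} = {y. y \<bullet> \<omega> = a}"
    using frontier_halfspace_lt[of \<omega> a] \<omega> by (force simp: inner_commute)
  then obtain l where l: "\<And>x. x \<bullet> \<omega> = a \<Longrightarrow> has_pv_integral (f x) (l * exp (- (norm x)\<^sup>2 / 4)) x"
    using stat unfolding nonlocal_gauss_stationary_def open_halfspace_def p_def[symmetric] f_def[abs_def]
    by auto
  have "K / (norm x + \<bar>a\<bar> + 3) powr p \<le> 2 * \<bar>l\<bar> * exp (- (norm x)\<^sup>2 / 4)" if x: "x \<bullet> \<omega> = a" for x
  proof -
    have "K / (norm x + \<bar>a\<bar> + 3) powr p \<le> 2 * \<bar>LINT y:{y. dist x y > \<epsilon>}|lborel. f x y\<bar>"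
      if "0 < \<epsilon>" "\<epsilon> < 1" for \<epsilon>
      using halfspace_kernel_integral_lower_bound[OF \<omega> a x, of p \<epsilon>] l[OF x] that s
      by (simp add: has_pv_integral_def f_def[abs_def] K_def p_def)
    then have "\<forall>\<^sub>F \<epsilon> in at_right 0. K / (norm x + \<bar>a\<bar> + 3) powr p
        \<le> 2 * \<bar>LINT y:{y. dist x y > \<epsilon>}|lborel. f x y\<bar>"
      by (auto simp: eventually_at_right_field intro!: exI[of _ 1])
    moreover have "((\<lambda>\<epsilon>. 2 * \<bar>LINT y:{y. dist x y > \<epsilon>}|lborel. f x y\<bar>)
        \<longlongrightarrow> 2 * \<bar>l * exp (- (norm x)\<^sup>2 / 4)\<bar>) (at_right 0)"
      using l[OF x] by (intro tendsto_intros) (simp add: has_pv_integral_def)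
    ultimately have "K / (norm x + \<bar>a\<bar> + 3) powr p \<le> 2 * \<bar>l * exp (- (norm x)\<^sup>2 / 4)\<bar>"
      by (intro tendsto_lowerbound) auto
    then show ?thesis
      by (simp add: abs_mult)
  qed
  moreover have "0 < K"
    using a content_cball_pos[of 1 "(a + 2) *\<^sub>R \<omega>"] by (simp add: K_def)
  ultimately show thesis
    using that unfolding p_def by blast
qed

lemma stationary_halfspace_through_origin:
  fixes \<omega> :: "real ^ 'n" and a s :: real
  assumes \<omega>: "norm \<omega> = 1" and s: "0 < s" and n: "2 \<le> CARD('n)"
    and stat: "nonlocal_gauss_stationary s (open_halfspace \<omega> a)"
  shows "a = 0"
proof (rule ccontr)
  assume a: "a \<noteq> 0"
  define p where "p = real CARD('n) + s"
  obtain K C where K: "0 < K" and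
    decay: "\<And>x. x \<bullet> \<omega> = a \<Longrightarrow> K / (norm x + \<bar>a\<bar> + 3) powr p \<le> C * exp (- (norm x)\<^sup>2 / 4)"
    using stationary_halfspace_decay[OF \<omega> s a stat] unfolding p_def by blast
  \<comment> \<open>Here the dimension enters: a direction inside the hyperplane is needed to go to
    infinity along the boundary.\<close>
  obtain v where v: "v \<noteq> 0" "orthogonal \<omega> v"
    using orthogonal_to_vector_exists[of \<omega>] n by auto
  define x where "x r = a *\<^sub>R \<omega> + (r / norm v) *\<^sub>R v" for r
  have "\<omega> \<bullet> \<omega> = 1"
    using \<omega> by (simp add: norm_eq_1)
  then have x_inner: "x r \<bullet> \<omega> = a" for r
    using v by (simp add: x_def inner_simps orthogonal_def inner_commute)
  have "(norm (x r))\<^sup>2 = a\<^sup>2 + r\<^sup>2" for r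
    using norm_add_Pythagorean[of "a *\<^sub>R \<omega>" "(r / norm v) *\<^sub>R v"] v \<omega>
    by (simp add: x_def orthogonal_clauses power_mult_distrib power_divide)
  \<comment> \<open>The lower bound on the norm controls the Gaussian; the triangle inequality below
    gives the upper bound that controls the power.\<close>
  then have x_norm: "r\<^sup>2 \<le> (norm (x r))\<^sup>2" for r
    by simp
  have x_norm_le: "norm (x r) \<le> \<bar>a\<bar> + r" if "0 \<le> r" for r
    using norm_triangle_ineq[of "a *\<^sub>R \<omega>" "(r / norm v) *\<^sub>R v"] that v \<omega> by (simp add: x_def)
  have "K \<le> \<bar>C\<bar> * ((r + (2 * \<bar>a\<bar> + 3)) powr p * exp (- r\<^sup>2 / 4))" if r: "0 \<le> r" for r
  proof -
    let ?N = "norm (x r) + \<bar>a\<bar> + 3"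
    have "0 < ?N powr p"
      by (smt (verit) norm_ge_zero powr_gt_zero)
    then have "K \<le> C * exp (- (norm (x r))\<^sup>2 / 4) * ?N powr p"
      using decay[OF x_inner, of r] by (simp add: pos_divide_le_eq)
    \<comment> \<open>Passing to \<open>\<bar>C\<bar>\<close> makes the right-hand side monotone in
      both factors, whatever the sign of \<open>C\<close>.\<close>
    also have "\<dots> \<le> \<bar>C\<bar> * exp (- r\<^sup>2 / 4) * (r + (2 * \<bar>a\<bar> + 3)) powr p"
      using x_norm[of r] x_norm_le[OF r] s by (intro mult_mono powr_mono2) (auto simp: p_def)
    finally show ?thesis
      by (simp add: mult_ac)
  qed
  then have "\<forall>\<^sub>F r in at_top. K \<le> \<bar>C\<bar> * ((r + (2 * \<bar>a\<bar> + 3)) powr p * exp (- r\<^sup>2 / 4))"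
    using eventually_ge_at_top[of 0] by (rule eventually_mono[rotated])
  moreover have "((\<lambda>r. \<bar>C\<bar> * ((r + (2 * \<bar>a\<bar> + 3)) powr p * exp (- r\<^sup>2 / 4))) \<longlongrightarrow> \<bar>C\<bar> * 0) at_top"
    using s by (intro tendsto_mult_left gauss_beats_powr) (simp add: p_def)
  ultimately have "K \<le> \<bar>C\<bar> * 0"
    by (intro tendsto_lowerbound) auto
  with K show False
    by simp
qed

text \<open>For \<open>CARD('n) = 1\<close> the boundary is a single point, and any principal value
  there is matched by some \<open>l\<close>; this is why the implication starts at dimension 2. The
  volume equivalence holds in every dimension, since the volume is \<open>V a / (2 * V 0)\<close>
  with \<open>V\<close> strictly increasing.\<close>

theorem theorem5:
  fixes \<omega> :: "real ^ 'n" and a s :: real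
  assumes "0 < s" and "s < 1" and "\<omega> \<in> sphere 0 1"
  shows "(2 \<le> CARD('n) \<and> nonlocal_gauss_stationary s (open_halfspace \<omega> a) \<longrightarrow> a = 0) \<and>
         (a = 0 \<longleftrightarrow> gauss_volume (open_halfspace \<omega> a) = 1 / 2)"
proof -
  have \<omega>: "norm \<omega> = 1"
    using assms by simp
  define V where "V b = (LINT x:{x. x \<bullet> \<omega> < b}|lborel. exp (- (norm x)\<^sup>2 / 2))" for b
  have V0: "2 * V 0 = (2 * pi) powr (CARD('n) / 2)" and "strict_mono V"
    using gauss_halfspace_integral_0[OF \<omega>] gauss_halfspace_integral_strict_mono[OF \<omega>]
    by (simp_all add: V_def[abs_def])
  have "gauss_volume (open_halfspace \<omega> a) = V a / (2 * V 0)"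
    unfolding V0 by (simp add: gauss_volume_def open_halfspace_def V_def)
  moreover have "V 0 > 0"
    using V0 by (smt (verit) pi_gt_zero powr_gt_zero)
  moreover have "V a = V 0 \<longleftrightarrow> a = 0"
    using \<open>strict_mono V\<close> by (simp add: strict_mono_eq)
  ultimately have "a = 0 \<longleftrightarrow> gauss_volume (open_halfspace \<omega> a) = 1 / 2"
    by (auto simp: field_simps)
  then show ?thesis
    using stationary_halfspace_through_origin[OF \<omega> assms(1)] by blast
qed

end
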